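(* Suppose that $\mathcal{P}$ is finite. The robust price optimization problem is randomization-proof if it satisfies strong duality: $$\max_{\mathbf{p}\in\mathcal{P}} \min_{\mathbf{u}\in\mathcal{U}} R(\mathbf{p},\mathbf{u}) = \min_{\mathbf{u}\in\mathcal{U}} \max_{\mathbf{p}\in\mathcal{P}} R(\mathbf{p},\mathbf{u}).$$
   Context: $\mathcal{P}\subseteq\mathbb{R}_+^I$ is the (nonempty, finite) set of feasible price vectors, $\mathcal{U}\subseteq\mathbb{R}^M$ is the uncertainty set of demand parameters, and $R:\mathcal{P}\times\mathcal{U}\to\mathbb{R}$ is the revenue function. The deterministic and randomized robust price optimization problems have optimal values $$Z^*_{\mathrm{DR}} = \max_{\mathbf{p}\in\mathcal{P}} \min_{\mathbf{u}\in\mathcal{U}} R(\mathbf{p},\mathbf{u}),\qquad Z^*_{\mathrm{RR}} = \max_{\boldsymbol{\pi}\in\Delta_{\mathcal{P}}} \min_{\mathbf{u}\in\mathcal{U}} \sum_{\mathbf{p}\in\mathcal{P}} \pi_{\mathbf{p}} R(\mathbf{p},\mathbf{u}),$$ where $\Delta_{\mathcal{P}} = \{\boldsymbol{\pi}\in\mathbb{R}^{\mathcal{P}} : \sum_{\mathbf{p}}\pi_{\mathbf{p}}=1,\ \pi_{\mathbf{p}}\ge 0\}$. The problem is called randomization-proof if $Z^*_{\mathrm{RR}} = Z^*_{\mathrm{DR}}$. *)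

theory Defs
  imports "HOL-Analysis.Analysis"
begin

text \<open>
  Optimal values live in \<^typ>\<open>ereal\<close>: no compactness of \<open>U\<close> and no continuity of \<open>R\<close> is assumed,
  so the worst case over \<open>U\<close> is an infimum, which is the minimum whenever the latter exists.
  Likewise, the maximum over the probability simplex is written as a supremum.
\<close>

definition Z_DR :: "'p set \<Rightarrow> 'u set \<Rightarrow> ('p \<Rightarrow> 'u \<Rightarrow> real) \<Rightarrow> ereal" where
  "Z_DR P U R = (MAX p\<in>P. INF u\<in>U. ereal (R p u))"

text \<open>Elements of \<open>\<real>\<^sup>P\<close> are functions on \<open>P\<close>, extended by \<^term>\<open>undefined\<close> outside \<open>P\<close>.\<close>

definition prob_simplex :: "'p set \<Rightarrow> ('p \<Rightarrow> real) set" where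
  "prob_simplex P = {\<pi> \<in> P \<rightarrow>\<^sub>E UNIV. (\<Sum>p\<in>P. \<pi> p) = 1 \<and> (\<forall>p\<in>P. \<pi> p \<ge> 0)}"

definition Z_RR :: "'p set \<Rightarrow> 'u set \<Rightarrow> ('p \<Rightarrow> 'u \<Rightarrow> real) \<Rightarrow> ereal" where
  "Z_RR P U R = (SUP \<pi>\<in>prob_simplex P. INF u\<in>U. ereal (\<Sum>p\<in>P. \<pi> p * R p u))"

definition randomization_proof :: "'p set \<Rightarrow> 'u set \<Rightarrow> ('p \<Rightarrow> 'u \<Rightarrow> real) \<Rightarrow> bool" where
  "randomization_proof P U R \<longleftrightarrow> Z_RR P U R = Z_DR P U R"

end

theory Submission imports Defs begin

text \<open>The randomized value is sandwiched between max-min and min-max. A fixed price is a point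
  mass, so randomizing can only help (\<open>Z_DR_le_Z_RR\<close>). Against a known
  \<open>u\<close>, a mixture earns an average of the revenues of single prices, hence no more than
  the best of them (\<open>Z_RR_le_INF_Max\<close>). Strong duality makes the two outer values
  equal, which closes the sandwich.\<close>

lemma prob_simplex_average_le_Max:
  assumes "finite P" and "P \<noteq> {}" and \<pi>: "\<pi> \<in> prob_simplex P"
  shows "ereal (\<Sum>p\<in>P. \<pi> p * f p) \<le> (MAX p\<in>P. ereal (f p))"
proof -
  \<comment> \<open>A maximiser \<open>q\<close> is fixed over the reals, so that the weighted sum
    can be bounded there before passing to \<open>ereal\<close>.\<close>
  have "Max (f ` P) \<in> f ` P"
    using assms by (intro Max_in) auto
  then obtain q where q: "q \<in> P" "f q = Max (f ` P)"
    by auto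
  have "(\<Sum>p\<in>P. \<pi> p * f p) \<le> (\<Sum>p\<in>P. \<pi> p * f q)"
    using \<pi> \<open>finite P\<close> by (intro sum_mono mult_left_mono) (auto simp: q prob_simplex_def)
  also have "\<dots> = f q"
    using \<pi> by (simp add: prob_simplex_def flip: sum_distrib_right)
  finally have "ereal (\<Sum>p\<in>P. \<pi> p * f p) \<le> ereal (f q)"
    by simp
  also have "\<dots> \<le> (MAX p\<in>P. ereal (f p))"
    using \<open>finite P\<close> q(1) by (intro Max_ge) auto
  finally show ?thesis .
qed

lemma Z_DR_le_Z_RR:
  assumes "finite P" and "P \<noteq> {}"
  shows "Z_DR P U R \<le> Z_RR P U R"
proof -
  have "(INF u\<in>U. ereal (R q u)) \<le> Z_RR P U R" if "q \<in> P" for q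
  proof -
    \<comment> \<open>Point mass at \<open>q\<close>; \<open>restrict\<close> makes it
      \<open>undefined\<close> off \<open>P\<close>, as membership in \<open>prob_simplex\<close>
      demands.\<close>
    define \<delta> where "\<delta> = restrict (\<lambda>p. if p = q then 1 else 0 :: real) P"
    have sum_\<delta>: "(\<Sum>p\<in>P. \<delta> p * f p) = f q" for f :: "_ \<Rightarrow> real"
    proof -
      have "(\<Sum>p\<in>P. \<delta> p * f p) = (\<Sum>p\<in>P. if p = q then f p else 0)"
        by (intro sum.cong) (auto simp: \<delta>_def)
      then show ?thesis
        using that \<open>finite P\<close> by simp
    qed
    have "\<delta> \<in> prob_simplex P"
      \<comment> \<open>The constant function 1 gives total mass 1.\<close>
      using sum_\<delta>[of "\<lambda>_. 1"] by (auto simp: prob_simplex_def \<delta>_def)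
    then have "(INF u\<in>U. ereal (\<Sum>p\<in>P. \<delta> p * R p u)) \<le> Z_RR P U R"
      unfolding Z_RR_def by (rule SUP_upper)
    then show ?thesis
      by (simp add: sum_\<delta>)
  qed
  then show ?thesis
    using assms by (simp add: Z_DR_def)
qed

text \<open>The averaging bound holds for each \<open>u\<close> separately, so it survives the
  infimum over \<open>U\<close>; its right-hand side does not depend on the mixture, so it also
  bounds the supremum.\<close>

lemma Z_RR_le_INF_Max:
  assumes "finite P" and "P \<noteq> {}"
  shows "Z_RR P U R \<le> (INF u\<in>U. MAX p\<in>P. ereal (R p u))"
  unfolding Z_RR_def
  by (intro SUP_least INF_mono' prob_simplex_average_le_Max assms)

theorem corollary1:
  fixes P :: "(real ^ 'i) set" and U :: "(real ^ 'm) set"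
    and R :: "real ^ 'i \<Rightarrow> real ^ 'm \<Rightarrow> real"
  assumes "finite P" and "P \<noteq> {}"
    and "P \<subseteq> {p. \<forall>i. 0 \<le> p $ i}"
    and "(MAX p\<in>P. INF u\<in>U. ereal (R p u)) = (INF u\<in>U. MAX p\<in>P. ereal (R p u))"
  shows "randomization_proof P U R"
  unfolding randomization_proof_def
proof (rule antisym)
  show "Z_RR P U R \<le> Z_DR P U R"
    \<comment> \<open>Strong duality turns the max-min in \<open>Z_DR\<close> into the min-max upper
      bound.\<close>
    using Z_RR_le_INF_Max[OF assms(1,2)] by (simp only: Z_DR_def assms(4))
qed (rule Z_DR_le_Z_RR[OF assms(1,2)])

end
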